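(* Let $(\mathcal{S}_1,\mathcal{B}_1)$ and $(\mathcal{S}_2,\mathcal{B}_2)$ be abstract measurable spaces and, for $i=1,2$, let $\mathcal{S}_i^\star$ be the set of probabilities on $(\mathcal{S}_i,\mathcal{B}_i)$ endowed with the smallest $\sigma$-field $\mathcal{B}_i^\star$ that makes $p\mapsto p(A)$ measurable for all $A\in\mathcal{B}_i$. Let $P$ be a partially exchangeable probability on $(\mathcal{S}_1^{n_1}\times\mathcal{S}_2^{n_2},\mathcal{B}_1^{n_1}\times\mathcal{B}_2^{n_2})$, and let $P_{k_1,k_2}$ be the projection of $P$ onto $(\mathcal{S}_1^{k_1}\times\mathcal{S}_2^{k_2},\mathcal{B}_1^{k_1}\times\mathcal{B}_2^{k_2})$. Then there exists a probability $\mu$ on $(\mathcal{S}_1^\star\times\mathcal{S}_2^\star,\mathcal{B}_1^\star\times\mathcal{B}_2^\star)$ such that if $P_{\mu k_1,k_2}$ is the projection of an infinitely partially exchangeable distribution onto $(\mathcal{S}_1^{k_1}\times\mathcal{S}_2^{k_2},\mathcal{B}_1^{k_1}\times\mathcal{B}_2^{k_2})$ with mixing measure $\mu$, then $$\|P_{k_1,k_2}-P_{\mu k_1,k_2}\|\le 2\beta((k_1,k_2),(n_1,n_2))\quad\text{for all } k_1\le n_1,\ k_2\le n_2,$$ where $\|\cdot\|$ denotes the total variation norm and $$\beta((k_1,k_2),(n_1,n_2))=1-n_1^{-k_1}\frac{n_1!}{(n_1-k_1)!}\,n_2^{-k_2}\frac{n_2!}{(n_2-k_2)!}.$$ This bound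 is tight.
   Context: Here $n_1,n_2,k_1,k_2$ are positive integers. A probability on $\mathcal{S}_1^{n_1}\times\mathcal{S}_2^{n_2}$ is partially exchangeable if it is invariant under the action of $S_{n_1}\times S_{n_2}$ in which the first factor permutes the $n_1$ coordinates in $\mathcal{S}_1$ and the second factor, independently, permutes the $n_2$ coordinates in $\mathcal{S}_2$. The projection onto $\mathcal{S}_1^{k_1}\times\mathcal{S}_2^{k_2}$ is the marginal law of the first $k_1$ coordinates in $\mathcal{S}_1$ and the first $k_2$ coordinates in $\mathcal{S}_2$. The projection of an infinitely partially exchangeable distribution with mixing measure $\mu$ is the mixture $$P_{\mu k_1,k_2}(A)=\int (p_1^{k_1}\times p_2^{k_2})(A)\,d\mu(p_1,p_2),$$ where $p_i^{k_i}$ is the $k_i$-fold product measure of $p_i$ on $\mathcal{S}_i^{k_i}$. *)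

theory Defs
  imports "HOL-Probability.Probability" "HOL-Combinatorics.Permutations"
begin

text \<open>
  The product \<open>S\<^sub>1\<^sup>m \<times> S\<^sub>2\<^sup>n\<close>; coordinates are indexed from 0, and a pair of coordinate
  families \<open>(x, y)\<close> consists of extensional functions on \<open>{..<m}\<close> and \<open>{..<n}\<close>.
\<close>

definition two_prod :: "'a measure \<Rightarrow> 'b measure \<Rightarrow> nat \<Rightarrow> nat \<Rightarrow> ((nat \<Rightarrow> 'a) \<times> (nat \<Rightarrow> 'b)) measure"
  where "two_prod M1 M2 m n = PiM {..<m} (\<lambda>_. M1) \<Otimes>\<^sub>M PiM {..<n} (\<lambda>_. M2)"

definition permute_coords ::
    "nat \<Rightarrow> nat \<Rightarrow> (nat \<Rightarrow> nat) \<Rightarrow> (nat \<Rightarrow> nat) \<Rightarrow>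
     (nat \<Rightarrow> 'a) \<times> (nat \<Rightarrow> 'b) \<Rightarrow> (nat \<Rightarrow> 'a) \<times> (nat \<Rightarrow> 'b)"
  where "permute_coords m n \<sigma> \<tau> = (\<lambda>(x, y). (\<lambda>i\<in>{..<m}. x (\<sigma> i), \<lambda>j\<in>{..<n}. y (\<tau> j)))"

definition partially_exchangeable ::
    "'a measure \<Rightarrow> 'b measure \<Rightarrow> nat \<Rightarrow> nat \<Rightarrow> ((nat \<Rightarrow> 'a) \<times> (nat \<Rightarrow> 'b)) measure \<Rightarrow> bool"
  where "partially_exchangeable M1 M2 m n P \<longleftrightarrow>
    prob_space P \<and> sets P = sets (two_prod M1 M2 m n) \<and>
    (\<forall>\<sigma> \<tau>. \<sigma> permutes {..<m} \<longrightarrow> \<tau> permutes {..<n} \<longrightarrow>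
      distr P (two_prod M1 M2 m n) (permute_coords m n \<sigma> \<tau>) = P)"

definition projection ::
    "'a measure \<Rightarrow> 'b measure \<Rightarrow> nat \<Rightarrow> nat \<Rightarrow> ((nat \<Rightarrow> 'a) \<times> (nat \<Rightarrow> 'b)) measure \<Rightarrow>
     ((nat \<Rightarrow> 'a) \<times> (nat \<Rightarrow> 'b)) measure"
  where "projection M1 M2 k l P =
    distr P (two_prod M1 M2 k l) (\<lambda>(x, y). (restrict x {..<k}, restrict y {..<l}))"

text \<open>
  The space of probabilities on \<open>M\<close> with the \<open>\<sigma>\<close>-field generated by the evaluations
  is the library's \<^const>\<open>prob_algebra\<close>.
\<close>

abbreviation mixing_space :: "'a measure \<Rightarrow> 'b measure \<Rightarrow> ('a measure \<times> 'b measure) measure"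
  where "mixing_space M1 M2 \<equiv> prob_algebra M1 \<Otimes>\<^sub>M prob_algebra M2"

text \<open>
  The mixture \<open>A \<mapsto> \<integral> (p\<^sub>1\<^sup>k \<times> p\<^sub>2\<^sup>l)(A) d\<mu>(p\<^sub>1, p\<^sub>2)\<close>, as a bind in the Giry monad; lemma
  \<open>emeasure_mixture\<close> below gives the integral formula.
\<close>

definition mixture ::
    "nat \<Rightarrow> nat \<Rightarrow> ('a measure \<times> 'b measure) measure \<Rightarrow> ((nat \<Rightarrow> 'a) \<times> (nat \<Rightarrow> 'b)) measure"
  where "mixture k l \<mu> = \<mu> \<bind> (\<lambda>(p1, p2). two_prod p1 p2 k l)"

text \<open>
  The total variation norm of the signed measure \<open>P - Q\<close>: the supremum over finite measurable
  partitions, not the distance normalised to 1. Lemma \<open>tv_norm_eq_SUP\<close> below: for probabilities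
  it is twice the supremum of \<open>\<bar>P A - Q A\<bar>\<close>.
\<close>

definition tv_norm :: "'a measure \<Rightarrow> 'a measure \<Rightarrow> real"
  where "tv_norm P Q =
    (SUP \<A> \<in> {\<A>. finite \<A> \<and> \<A> \<subseteq> sets P \<and> partition_on (space P) \<A>}.
       \<Sum>A\<in>\<A>. \<bar>measure P A - measure Q A\<bar>)"

definition beta :: "nat \<times> nat \<Rightarrow> nat \<times> nat \<Rightarrow> real"
  where "beta = (\<lambda>(k1, k2) (n1, n2).
    1 - inverse (real n1 ^ k1) * (fact n1 / fact (n1 - k1)) *
        (inverse (real n2 ^ k2) * (fact n2 / fact (n2 - k2))))"

lemma measurable_PiM_power:
  "(\<lambda>p. PiM {..<k::nat} (\<lambda>_. p)) \<in> prob_algebra M \<rightarrow>\<^sub>M prob_algebra (PiM {..<k} (\<lambda>_. M))"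
proof (rule measurable_prob_algebra_generated[OF sets_PiM Int_stable_prod_algebra
      prod_algebra_sets_into_space])
  fix p assume p: "p \<in> space (prob_algebra M)"
  then show "prob_space (PiM {..<k} (\<lambda>_. p))"
    by (intro prob_space_PiM) (auto simp: space_prob_algebra)
  show "sets (PiM {..<k} (\<lambda>_. p)) = sets (PiM {..<k} (\<lambda>_. M))"
    using p by (intro sets_PiM_cong) (auto simp: space_prob_algebra)
next
  fix X assume "X \<in> prod_algebra {..<k} (\<lambda>_. M)"
  then obtain E where X: "X = Pi\<^sub>E {..<k} E" and E: "E \<in> (\<Pi> i\<in>{..<k}. sets M)"
    by (auto simp: prod_algebra_eq_finite)
  have "emeasure (PiM {..<k} (\<lambda>_. p)) X = (\<Prod>i<k. emeasure p (E i))"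
    if "p \<in> space (prob_algebra M)" for p
  proof -
    interpret prob_space p using that by (simp add: space_prob_algebra)
    interpret product_sigma_finite "\<lambda>_::nat. p" ..
    show ?thesis
      unfolding X using that E by (intro emeasure_PiM) (auto simp: space_prob_algebra)
  qed
  moreover have "(\<lambda>p. emeasure p (E i)) \<in> borel_measurable (prob_algebra M)" if "i < k" for i
    using E that unfolding prob_algebra_def
    by (intro measurable_restrict_space1 measurable_emeasure_subprob_algebra) auto
  ultimately show "(\<lambda>p. emeasure (PiM {..<k} (\<lambda>_. p)) X) \<in> borel_measurable (prob_algebra M)"
    by (subst measurable_cong) auto
qed

lemma measurable_two_prod:
  "(\<lambda>(p1, p2). two_prod p1 p2 k l) \<in> mixing_space M1 M2 \<rightarrow>\<^sub>M prob_algebra (two_prod M1 M2 k l)"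
  unfolding two_prod_def split_beta
  by (intro measurable_pair_prob measurable_compose[OF measurable_fst measurable_PiM_power]
      measurable_compose[OF measurable_snd measurable_PiM_power])

lemma
  assumes "prob_space \<mu>" "sets \<mu> = sets (mixing_space M1 M2)"
  shows prob_space_mixture: "prob_space (mixture k l \<mu>)"
    and sets_mixture: "sets (mixture k l \<mu>) = sets (two_prod M1 M2 k l)"
    and emeasure_mixture: "A \<in> sets (two_prod M1 M2 k l) \<Longrightarrow>
      emeasure (mixture k l \<mu>) A = (\<integral>\<^sup>+ (p1, p2). emeasure (two_prod p1 p2 k l) A \<partial>\<mu>)"
proof -
  have mu: "\<mu> \<in> space (prob_algebra (mixing_space M1 M2))"
    using assms by (simp add: space_prob_algebra)
  show "prob_space (mixture k l \<mu>)"
    unfolding mixture_def by (rule prob_space_bind'[OF mu measurable_two_prod])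
  show "sets (mixture k l \<mu>) = sets (two_prod M1 M2 k l)"
    unfolding mixture_def by (rule sets_bind'[OF mu measurable_two_prod])
  show "emeasure (mixture k l \<mu>) A = (\<integral>\<^sup>+ (p1, p2). emeasure (two_prod p1 p2 k l) A \<partial>\<mu>)"
    if "A \<in> sets (two_prod M1 M2 k l)"
    unfolding mixture_def using emeasure_bind_prob_algebra[OF mu measurable_two_prod that]
    by (simp add: case_prod_beta')
qed

lemma tv_norm_eq_SUP:
  assumes "prob_space P" "prob_space Q" and sets_eq: "sets Q = sets P"
  shows "tv_norm P Q = 2 * (SUP A\<in>sets P. \<bar>measure P A - measure Q A\<bar>)"
proof -
  interpret P: prob_space P by fact
  interpret Q: prob_space Q by fact
  have sp: "space Q = space P" using sets_eq by (rule sets_eq_imp_space_eq)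
  define d where "d A = measure P A - measure Q A" for A
  let ?S = "SUP A\<in>sets P. \<bar>d A\<bar>"
  let ?Part = "{\<A>. finite \<A> \<and> \<A> \<subseteq> sets P \<and> partition_on (space P) \<A>}"
  have "\<bar>d A\<bar> \<le> 1" for A
    unfolding d_def using P.prob_le_1[of A] Q.prob_le_1[of A]
    by (simp add: abs_le_iff add.commute add_increasing2 le_diff_eq diff_le_eq)
  then have bdd: "bdd_above ((\<lambda>A. \<bar>d A\<bar>) ` sets P)"
    by (auto intro!: bdd_aboveI[of _ 1])
  have le: "\<bar>d A\<bar> \<le> ?S" if "A \<in> sets P" for A
    using bdd that by (rule cSUP_upper2) simp
  have d_Union: "d (\<Union>\<A>) = (\<Sum>A\<in>\<A>. d A)" if "finite \<A>" "\<A> \<subseteq> sets P" "disjoint \<A>" for \<A>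
    using that sets_eq
    by (simp add: d_def sum_subtractf P.finite_measure_finite_Union[of \<A> id, simplified]
        Q.finite_measure_finite_Union[of \<A> id, simplified] disjoint_family_on_disjoint_image
        disjoint_def disjoint_family_on_def)
  have upper: "(\<Sum>A\<in>\<A>. \<bar>d A\<bar>) \<le> 2 * ?S" if "\<A> \<in> ?Part" for \<A>
  proof -
    let ?p = "{A\<in>\<A>. 0 \<le> d A}" and ?n = "{A\<in>\<A>. \<not> 0 \<le> d A}"
    have \<A>: "finite \<A>" "\<A> \<subseteq> sets P" "disjoint \<A>"
      using that by (auto simp: partition_on_def)
    have sub: "disjoint ?p" "disjoint ?n" using \<A>(3) by (auto simp: disjoint_def)
    have "(\<Sum>A\<in>\<A>. \<bar>d A\<bar>) = (\<Sum>A\<in>?p. \<bar>d A\<bar>) + (\<Sum>A\<in>?n. \<bar>d A\<bar>)"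
      using \<A>(1) by (subst sum.union_disjoint[symmetric]) (auto intro!: sum.cong)
    also have "(\<Sum>A\<in>?p. \<bar>d A\<bar>) = d (\<Union>?p)"
      using \<A> sub by (subst d_Union) auto
    also have "(\<Sum>A\<in>?n. \<bar>d A\<bar>) = - d (\<Union>?n)"
      using \<A> sub by (subst d_Union) (auto simp: sum_negf[symmetric] intro!: sum.cong)
    also have "d (\<Union>?p) + - d (\<Union>?n) \<le> ?S + ?S"
    proof -
      have "\<Union>?p \<in> sets P" "\<Union>?n \<in> sets P"
        using \<A> by (auto intro!: sets.finite_Union)
      from this[THEN le] show ?thesis by linarith
    qed
    finally show ?thesis by simp
  qed
  have bdd': "bdd_above ((\<lambda>\<A>. \<Sum>A\<in>\<A>. \<bar>d A\<bar>) ` ?Part)"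
    using upper by (auto intro!: bdd_aboveI[of _ "2 * ?S"])
  have d0: "d {} = 0" and d1: "d (space P) = 0"
    using P.prob_space Q.prob_space by (simp_all add: d_def sp)
  have triv: "{space P} \<in> ?Part"
    using P.not_empty by (auto simp: partition_on_def)
  have tv: "tv_norm P Q = (SUP \<A>\<in>?Part. \<Sum>A\<in>\<A>. \<bar>d A\<bar>)"
    by (simp add: tv_norm_def d_def)
  have lower: "2 * \<bar>d A\<bar> \<le> tv_norm P Q" if A: "A \<in> sets P" for A
  proof (cases "A = {} \<or> A = space P")
    case True
    have "0 = (\<Sum>A\<in>{space P}. \<bar>d A\<bar>)" by (simp add: d1)
    also have "\<dots> \<le> tv_norm P Q"
      unfolding tv by (rule cSUP_upper[OF triv bdd'])
    finally show ?thesis using True d0 d1 by auto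
  next
    case False
    have sub: "A \<subseteq> space P" using A by (rule sets.sets_into_space)
    have part: "{A, space P - A} \<in> ?Part"
      using A False sub by (auto simp: partition_on_def disjoint_def)
    have "d (space P - A) = - d A"
      using P.prob_compl[OF A] Q.prob_compl[of A] A sets_eq by (simp add: d_def sp)
    moreover have "A \<noteq> space P - A" using False sub by blast
    ultimately have "2 * \<bar>d A\<bar> = (\<Sum>B\<in>{A, space P - A}. \<bar>d B\<bar>)" by simp
    also have "\<dots> \<le> tv_norm P Q"
      unfolding tv by (rule cSUP_upper[OF part bdd'])
    finally show ?thesis .
  qed
  have "tv_norm P Q \<le> 2 * ?S"
    unfolding tv using triv by (intro cSUP_least upper) blast+
  moreover have "?S \<le> tv_norm P Q / 2"
  proof (rule cSUP_least)
    show "sets P \<noteq> {}" by blast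
    show "\<bar>d A\<bar> \<le> tv_norm P Q / 2" if "A \<in> sets P" for A using lower[OF that] by simp
  qed
  ultimately show ?thesis unfolding d_def by simp
qed

end

theory Submission
  imports Defs
begin

text \<open>
  The mixing measure is the law under \<open>P\<close> of the pair of empirical measures of \<open>x\<close> and \<open>y\<close>.
  The \<open>k\<close>-fold power of the empirical measure of \<open>x\<^sub>0, \<dots>, x\<^sub>n\<^sub>-\<^sub>1\<close> is the law of
  \<open>x \<circ> f\<close> for a uniformly random \<open>f : {..<k} \<rightarrow> {..<n}\<close>, so the mixture averages, over all
  pairs \<open>(f, g)\<close>, the law of \<open>(x \<circ> f, y \<circ> g)\<close> under \<open>P\<close>. By exchangeability this law is the
  projection of \<open>P\<close> whenever \<open>f\<close> and \<open>g\<close> are both injective, and the proportion of the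
  remaining pairs is exactly \<open>\<beta>\<close>.

  For tightness let \<open>P\<close> be sampling without replacement from \<open>{..<n1}\<close> and \<open>{..<n2}\<close>. Its
  projections give mass 1 to pairs of injective tuples, whereas every product of powers gives them
  at most \<open>1 - \<beta>\<close>: by Maclaurin's inequality the probability that \<open>k\<close> independent draws from a
  law on \<open>n\<close> points are distinct is largest for the uniform law.
\<close>

section \<open>Injective index functions and their number, the falling factorial\<close>

text \<open>Extensionality makes the members points of the finite product space, so the same set
  serves as index set in the upper bound and as the event of distinct draws in the lower
  bound.\<close>

definition inj_funs :: "nat \<Rightarrow> nat \<Rightarrow> (nat \<Rightarrow> nat) set"
  where "inj_funs k n = {f \<in> {..<k} \<rightarrow>\<^sub>E {..<n}. inj_on f {..<k}}"

lemma finite_inj_funs [simp]: "finite (inj_funs k n)"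
  unfolding inj_funs_def by (rule finite_subset[OF _ finite_PiE[of "{..<k}" "\<lambda>_. {..<n}"]]) auto

lemma inj_funs_subset: "inj_funs k n \<subseteq> {..<k} \<rightarrow>\<^sub>E {..<n}"
  by (auto simp: inj_funs_def)

lemma inj_funs_0 [simp]: "inj_funs 0 n = {\<lambda>_. undefined}"
  by (auto simp: inj_funs_def)

lemma sum_inj_funs_Suc:
  fixes h :: "(nat \<Rightarrow> nat) \<Rightarrow> real"
  shows "(\<Sum>f\<in>inj_funs (Suc k) n. h f) =
    (\<Sum>f\<in>inj_funs k n. \<Sum>j\<in>{..<n} - f ` {..<k}. h (f(k := j)))"
proof -
  have "(\<Sum>f\<in>inj_funs k n. \<Sum>j\<in>{..<n} - f ` {..<k}. h (f(k := j))) =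
      (\<Sum>(f, j)\<in>Sigma (inj_funs k n) (\<lambda>f. {..<n} - f ` {..<k}). h (f(k := j)))"
    by (subst sum.Sigma) auto
  also have "\<dots> = (\<Sum>f\<in>inj_funs (Suc k) n. h f)"
  \<comment> \<open>Cutting off the last value resets it to \<open>undefined\<close>, the default
    outside \<open>{..<k}\<close>, which keeps the shortened tuple extensional.\<close>
  proof (rule sum.reindex_bij_witness[where i = "\<lambda>f. (f(k := undefined), f k)"
        and j = "\<lambda>(f, j). f(k := j)"], goal_cases)
    case (1 a)
    then show ?case
      by (auto simp: inj_funs_def PiE_def extensional_def fun_eq_iff)
  next
    case (2 a)
    then obtain f j where "a = (f, j)" and f: "f \<in> {..<k} \<rightarrow>\<^sub>E {..<n}" "inj_on f {..<k}"
      and j: "j \<in> {..<n} - f ` {..<k}"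
      by (auto simp: inj_funs_def)
    moreover have "f(k := j) \<in> {..<Suc k} \<rightarrow>\<^sub>E {..<n}"
      using f(1) j by (auto simp: lessThan_Suc intro: PiE_fun_upd)
    moreover have "inj_on (f(k := j)) {..<Suc k}"
      using f(2) j by (auto simp: lessThan_Suc inj_on_fun_updI)
    ultimately show ?case by (simp add: inj_funs_def)
  next
    case (3 f)
    then show ?case by simp
  next
    case (4 f)
    then have f: "f \<in> {..<Suc k} \<rightarrow>\<^sub>E {..<n}" "inj_on f {..<Suc k}"
      by (auto simp: inj_funs_def)
    from f(1) have "f(k := undefined) \<in> {..<k} \<rightarrow>\<^sub>E {..<n}" "f k \<in> {..<n}"
      by (auto simp: PiE_iff extensional_def less_Suc_eq)
    moreover from f(2) have "inj_on f {..<k}" "f k \<notin> f ` {..<k}"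
      by (auto simp: lessThan_Suc)
    ultimately show ?case
      by (auto simp: inj_funs_def inj_on_def)
  next
    case (5 a)
    then show ?case by auto
  qed
  finally show ?thesis ..
qed

lemma card_unused_values:
  assumes "f \<in> inj_funs k n"
  shows "card ({..<n} - f ` {..<k}) = n - k"
  using assms by (subst card_Diff_subset) (auto simp: inj_funs_def card_image PiE_def Pi_def)

lemma inj_funs_le: "f \<in> inj_funs k n \<Longrightarrow> k \<le> n"
  using card_inj_on_le[of f "{..<k}" "{..<n}"] by (auto simp: inj_funs_def PiE_def Pi_def)

text \<open>The recursion at \<open>h = 1\<close>: the new position has \<open>n - k\<close> free
  values. For \<open>n \<le> k\<close> both sides are 0, in accordance with truncated
  subtraction.\<close>

lemma card_inj_funs_Suc: "real (card (inj_funs (Suc k) n)) = real (card (inj_funs k n)) * real (n - k)"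
  using sum_inj_funs_Suc[of "\<lambda>_. 1" k n] by (simp add: card_unused_values)

lemma card_inj_funs: "k \<le> n \<Longrightarrow> real (card (inj_funs k n)) = fact n / fact (n - k)"
proof (induction k)
  case (Suc k)
  then have "fact (n - k) = real (n - k) * fact (n - Suc k)"
    by (metis Suc_diff_Suc Suc_le_lessD fact_Suc of_nat_fact of_nat_mult)
  with Suc show ?case by (simp add: card_inj_funs_Suc field_simps)
qed simp

section \<open>Maclaurin's inequality for the probability of distinct draws\<close>

text \<open>Precomposition with a transposition of two positions is an involution of the index set.
  This symmetry pairs the summands in \<open>sum_inj_funs_exchange\<close>.\<close>

lemma sum_inj_funs_swap:
  fixes h :: "(nat \<Rightarrow> nat) \<Rightarrow> real"
  assumes "i \<le> k"
  shows "(\<Sum>f\<in>inj_funs (Suc k) n. h (f \<circ> Transposition.transpose i k)) = (\<Sum>f\<in>inj_funs (Suc k) n. h f)"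
proof (rule sum.reindex_bij_witness[where i = "\<lambda>f. f \<circ> Transposition.transpose i k" and j = "\<lambda>f. f \<circ> Transposition.transpose i k"])
  have tr: "Transposition.transpose i k permutes {..<Suc k}"
    using assms by (intro permutes_swap_id) auto
  fix f assume f: "f \<in> inj_funs (Suc k) n"
  have "inj_on (f \<circ> Transposition.transpose i k) {..<Suc k}"
    using f permutes_inj_on[OF tr] by (intro comp_inj_on) (auto simp: permutes_image[OF tr] inj_funs_def)
  then show "f \<circ> Transposition.transpose i k \<in> inj_funs (Suc k) n"
    using f permutes_in_image[OF tr] unfolding inj_funs_def PiE_def Pi_def extensional_def
    by (auto simp del: lessThan_Suc)
  then show "f \<circ> Transposition.transpose i k \<in> inj_funs (Suc k) n" .
qed (auto simp: o_assoc[symmetric])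

text \<open>Size bias: the weight \<open>\<Prod>m<k. p (f m)\<close> contains the factor
  \<open>p (f i)\<close> but not \<open>p (f k)\<close>, so it favours large values at position
  \<open>i\<close>.\<close>

lemma sum_inj_funs_exchange:
  fixes p :: "nat \<Rightarrow> real"
  assumes p: "\<And>j. j < n \<Longrightarrow> 0 \<le> p j" and i: "i < k"
  shows "(\<Sum>f\<in>inj_funs (Suc k) n. (\<Prod>m<k. p (f m)) * p (f k))
    \<le> (\<Sum>f\<in>inj_funs (Suc k) n. (\<Prod>m<k. p (f m)) * p (f i))"
proof -
  let ?I = "inj_funs (Suc k) n"
  \<comment> \<open>The factors at positions other than \<open>i\<close> and \<open>k\<close> are
    untouched by the swap and can be pulled out of the square.\<close>
  define r where "r f = (\<Prod>m\<in>{..<k} - {i}. p (f m))" for f :: "nat \<Rightarrow> nat"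
  have prod: "(\<Prod>m<k. p (f m)) = p (f i) * r f" for f
    unfolding r_def using i by (subst prod.remove[of _ i]) auto
  have r_swap: "r (f \<circ> Transposition.transpose i k) = r f" for f
    unfolding r_def using i by (intro prod.cong) (auto simp: Transposition.transpose_def)
  have r_nonneg: "0 \<le> r f" if "f \<in> ?I" for f
    unfolding r_def using that p by (intro prod_nonneg) (auto simp: inj_funs_def PiE_def Pi_def)
  \<comment> \<open>Swapping the values at \<^term>\<open>i\<close> and \<^term>\<open>k\<close> permutes the index set; adding the two
    copies of the sum completes the squares.\<close>
  define c where "c f = (\<Prod>m<k. p (f m)) * (p (f i) - p (f k))" for f :: "nat \<Rightarrow> nat"
  have "2 * (\<Sum>f\<in>?I. c f) = (\<Sum>f\<in>?I. c f) + (\<Sum>f\<in>?I. c (f \<circ> Transposition.transpose i k))"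
    using sum_inj_funs_swap[of i k c n] i by simp
  also have "\<dots> = (\<Sum>f\<in>?I. r f * (p (f i) - p (f k))\<^sup>2)"
    unfolding sum.distrib[symmetric]
    by (intro sum.cong refl) (simp add: c_def prod r_swap[unfolded o_def] algebra_simps power2_eq_square)
  also have "\<dots> \<ge> 0"
    by (intro sum_nonneg mult_nonneg_nonneg r_nonneg) auto
  finally have "0 \<le> (\<Sum>f\<in>?I. c f)" by simp
  also have "\<dots> = (\<Sum>f\<in>?I. (\<Prod>m<k. p (f m)) * p (f i)) - (\<Sum>f\<in>?I. (\<Prod>m<k. p (f m)) * p (f k))"
    by (simp add: c_def right_diff_distrib sum_subtractf)
  finally show ?thesis by simp
qed

lemma sum_prod_inj_funs_Suc_le:
  fixes p :: "nat \<Rightarrow> real"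
  assumes p: "\<And>j. j < n \<Longrightarrow> 0 \<le> p j" and p1: "(\<Sum>j<n. p j) = 1" and k: "k \<le> n"
  shows "real n * (\<Sum>f\<in>inj_funs (Suc k) n. \<Prod>m<Suc k. p (f m))
    \<le> real (n - k) * (\<Sum>f\<in>inj_funs k n. \<Prod>m<k. p (f m))"
proof -
  let ?w = "\<lambda>f. \<Prod>m<k. p (f m)"
  define E where "E = (\<Sum>f\<in>inj_funs k n. ?w f)"
  define E' where "E' = (\<Sum>f\<in>inj_funs (Suc k) n. ?w f * p (f k))"
  define D where "D = (\<Sum>f\<in>inj_funs k n. ?w f * (\<Sum>i<k. p (f i)))"
  have "E' = (\<Sum>f\<in>inj_funs k n. ?w f * (\<Sum>j\<in>{..<n} - f ` {..<k}. p j))"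
    unfolding E'_def by (simp add: sum_inj_funs_Suc sum_distrib_left)
  also have "\<dots> = (\<Sum>f\<in>inj_funs k n. ?w f * (1 - (\<Sum>i<k. p (f i))))"
  proof (intro sum.cong refl arg_cong2[where f = "(*)"])
    fix f assume "f \<in> inj_funs k n"
    then show "(\<Sum>j\<in>{..<n} - f ` {..<k}. p j) = 1 - (\<Sum>i<k. p (f i))"
      unfolding p1[symmetric]
      by (subst sum_diff) (auto simp: inj_funs_def PiE_def Pi_def sum.reindex)
  qed
  also have "\<dots> = E - D"
    by (simp add: E_def D_def right_diff_distrib sum_subtractf)
  finally have ED: "E' = E - D" .
  have "real k * E' = (\<Sum>i<k. \<Sum>f\<in>inj_funs (Suc k) n. ?w f * p (f k))"
    by (simp add: E'_def)
  also have "\<dots> \<le> (\<Sum>i<k. \<Sum>f\<in>inj_funs (Suc k) n. ?w f * p (f i))"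
    using p by (intro sum_mono sum_inj_funs_exchange) auto
  also have "\<dots> = (\<Sum>f\<in>inj_funs (Suc k) n. ?w f * (\<Sum>i<k. p (f i)))"
    by (subst sum.swap) (simp add: sum_distrib_left)
  \<comment> \<open>The summand does not involve the last value \<open>f k\<close>, for which there
    are \<open>n - k\<close> choices.\<close>
  also have "\<dots> = real (n - k) * D"
    by (simp add: sum_inj_funs_Suc D_def card_unused_values sum_distrib_left mult_ac)
  finally have "real k * E' \<le> real (n - k) * D" .
  then have "real n * E' \<le> real (n - k) * (E' + D)"
    using k by (simp add: of_nat_diff algebra_simps)
  then show ?thesis
    unfolding ED by (simp add: E_def[symmetric] E'_def[symmetric] ED)
qed

text \<open>The left side is the probability that \<open>k\<close> independent draws from
  \<open>p\<close> are distinct; the right side is its value for the uniform law. Both start at 1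
  for \<open>k = 0\<close>, and each further draw costs the left side at least the factor
  \<open>(n - k) / n\<close> by which the right side shrinks.\<close>

lemma sum_prod_inj_funs_le:
  fixes p :: "nat \<Rightarrow> real"
  assumes p: "\<And>j. j < n \<Longrightarrow> 0 \<le> p j" and p1: "(\<Sum>j<n. p j) = 1" and k: "k \<le> n" and n: "0 < n"
  shows "(\<Sum>f\<in>inj_funs k n. \<Prod>m<k. p (f m)) \<le> real (card (inj_funs k n)) / real n ^ k"
  using k
proof (induction k)
  case (Suc k)
  have "real n * (\<Sum>f\<in>inj_funs (Suc k) n. \<Prod>m<Suc k. p (f m))
      \<le> real (n - k) * (\<Sum>f\<in>inj_funs k n. \<Prod>m<k. p (f m))"
    using Suc.prems by (intro sum_prod_inj_funs_Suc_le p p1) auto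
  also have "\<dots> \<le> real (n - k) * (real (card (inj_funs k n)) / real n ^ k)"
    using Suc by (intro mult_left_mono) auto
  finally show ?case
    using n by (simp add: card_inj_funs_Suc field_simps)
qed simp

section \<open>Extension of injections to permutations\<close>

lemma inj_funs_extend_permutes:
  assumes "f \<in> inj_funs k n"
  obtains \<sigma> where "\<sigma> permutes {..<n}" "\<And>i. i < k \<Longrightarrow> \<sigma> i = f i"
proof -
  have k: "k \<le> n" using assms by (rule inj_funs_le)
  have f: "bij_betw f {..<k} (f ` {..<k})" "f ` {..<k} \<subseteq> {..<n}"
    using assms by (auto simp: inj_funs_def PiE_def Pi_def bij_betw_def)
  have "card {k..<n} = card ({..<n} - f ` {..<k})"
    using card_unused_values[OF assms] by simp
  then obtain g where g: "bij_betw g {k..<n} ({..<n} - f ` {..<k})"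
    using finite_same_card_bij[of "{k..<n}" "{..<n} - f ` {..<k}"] by auto
  define \<sigma> where "\<sigma> i = (if i < k then f i else if i < n then g i else i)" for i
  have "bij_betw \<sigma> ({..<k} \<union> {k..<n}) (f ` {..<k} \<union> ({..<n} - f ` {..<k}))"
  proof (rule bij_betw_combine)
    show "bij_betw \<sigma> {..<k} (f ` {..<k})"
      using f(1) by (subst bij_betw_cong[of _ _ f]) (auto simp: \<sigma>_def)
    show "bij_betw \<sigma> {k..<n} ({..<n} - f ` {..<k})"
      using g by (subst bij_betw_cong[of _ _ g]) (auto simp: \<sigma>_def)
  qed auto
  moreover have "{..<k} \<union> {k..<n} = {..<n}" "f ` {..<k} \<union> ({..<n} - f ` {..<k}) = {..<n}"
    using k f(2) by auto
  ultimately have "\<sigma> permutes {..<n}"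
    using k by (intro bij_imp_permutes) (auto simp: \<sigma>_def)
  then show ?thesis by (rule that) (simp add: \<sigma>_def)
qed

section \<open>Empirical measures and their powers\<close>

text \<open>Written as an image of the uniform law on indices, so that its powers become images of
  the uniform law on index functions.\<close>

definition empirical :: "'a measure \<Rightarrow> nat \<Rightarrow> (nat \<Rightarrow> 'a) \<Rightarrow> 'a measure"
  where "empirical M n x = distr (uniform_count_measure {..<n}) M x"

text \<open>Makes the law of the empirical measure meaningful on the evaluation \<sigma>-field. It
  reduces to joint measurability of \<open>(x, i) \<mapsto> x i\<close>, which holds because
  \<open>i\<close> ranges over a countable set and each fixed \<open>i\<close> gives a coordinate
  map.\<close>

lemma measurable_empirical:
  assumes "0 < n"
  shows "empirical M n \<in> PiM {..<n} (\<lambda>_. M) \<rightarrow>\<^sub>M prob_algebra M"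
  unfolding empirical_def
proof (rule measurable_distr_prob_space2)
  show "(\<lambda>x. uniform_count_measure {..<n}) \<in> PiM {..<n} (\<lambda>_. M) \<rightarrow>\<^sub>M prob_algebra (count_space {..<n})"
    using assms
    by (intro measurable_const)
       (auto simp: space_prob_algebra sets_uniform_count_measure intro!: prob_space_uniform_count_measure)
  have "(\<lambda>z. fst z (snd z)) \<in> PiM {..<n} (\<lambda>_. M) \<Otimes>\<^sub>M count_space {..<n} \<rightarrow>\<^sub>M M"
    by (rule measurable_compose_countable'[where I = "{..<n}"]) auto
  then show "(\<lambda>(x, y). x y) \<in> PiM {..<n} (\<lambda>_. M) \<Otimes>\<^sub>M count_space {..<n} \<rightarrow>\<^sub>M M"
    by (simp add: case_prod_beta')
qed

lemma PiM_uniform_count_measure: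
  assumes "finite I" and B: "finite B" "B \<noteq> {}"
  shows "PiM I (\<lambda>_. uniform_count_measure B) = uniform_count_measure (I \<rightarrow>\<^sub>E B)"
proof -
  interpret prob_space "uniform_count_measure B"
    using B by (rule prob_space_uniform_count_measure)
  interpret product_sigma_finite "\<lambda>_. uniform_count_measure B" ..
  have fin: "finite (I \<rightarrow>\<^sub>E B)" using assms by (intro finite_PiE)
  show ?thesis
  proof (rule PiM_eqI[symmetric, OF \<open>finite I\<close>])
    have "sets (PiM I (\<lambda>_. uniform_count_measure B)) = sets (PiM I (\<lambda>_. count_space B))"
      by (intro sets_PiM_cong) (auto simp: sets_uniform_count_measure)
    also have "\<dots> = sets (uniform_count_measure (I \<rightarrow>\<^sub>E B))"
      using assms by (simp add: count_space_PiM_finite countable_finite sets_uniform_count_measure)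
    finally show "sets (uniform_count_measure (I \<rightarrow>\<^sub>E B)) = sets (PiM I (\<lambda>_. uniform_count_measure B))" ..
  next
    fix A assume "\<And>i. i \<in> I \<Longrightarrow> A i \<in> sets (uniform_count_measure B)"
    then have A: "A i \<subseteq> B" if "i \<in> I" for i
      using that by (auto simp: sets_uniform_count_measure)
    then have "Pi\<^sub>E I A \<subseteq> I \<rightarrow>\<^sub>E B" by (intro PiE_mono)
    then have "emeasure (uniform_count_measure (I \<rightarrow>\<^sub>E B)) (Pi\<^sub>E I A) =
        ennreal ((\<Prod>i\<in>I. real (card (A i))) / (\<Prod>i\<in>I. real (card B)))"
      using fin \<open>finite I\<close> by (simp add: emeasure_uniform_count_measure card_PiE)
    also have "\<dots> = (\<Prod>i\<in>I. emeasure (uniform_count_measure B) (A i))"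
      using A B by (subst prod_dividef[symmetric])
        (simp add: prod_ennreal[symmetric] emeasure_uniform_count_measure)
    finally show "emeasure (uniform_count_measure (I \<rightarrow>\<^sub>E B)) (Pi\<^sub>E I A) =
        (\<Prod>i\<in>I. emeasure (uniform_count_measure B) (A i))" .
  qed
qed

lemma pair_uniform_count_measure:
  assumes "finite A" "A \<noteq> {}" "finite B" "B \<noteq> {}"
  shows "uniform_count_measure A \<Otimes>\<^sub>M uniform_count_measure B = uniform_count_measure (A \<times> B)"
proof (rule pair_measure_eqI)
  interpret A: prob_space "uniform_count_measure A"
    using assms(1,2) by (rule prob_space_uniform_count_measure)
  interpret B: prob_space "uniform_count_measure B"
    using assms(3,4) by (rule prob_space_uniform_count_measure)
  show "sigma_finite_measure (uniform_count_measure A)" "sigma_finite_measure (uniform_count_measure B)"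
    by unfold_locales
  have "sets (uniform_count_measure A \<Otimes>\<^sub>M uniform_count_measure B) =
      sets (count_space A \<Otimes>\<^sub>M count_space B)"
    by (intro sets_pair_measure_cong) (auto simp: sets_uniform_count_measure)
  also have "\<dots> = sets (uniform_count_measure (A \<times> B))"
    using assms
    by (subst pair_measure_countable) (auto simp: countable_finite sets_uniform_count_measure)
  finally show "sets (uniform_count_measure A \<Otimes>\<^sub>M uniform_count_measure B) =
      sets (uniform_count_measure (A \<times> B))" .
next
  fix X Y assume "X \<in> sets (uniform_count_measure A)" "Y \<in> sets (uniform_count_measure B)"
  then have XY: "X \<subseteq> A" "Y \<subseteq> B" by (auto simp: sets_uniform_count_measure)
  then have "X \<times> Y \<subseteq> A \<times> B" by auto
  with XY show "emeasure (uniform_count_measure A) X * emeasure (uniform_count_measure B) Y =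
      emeasure (uniform_count_measure (A \<times> B)) (X \<times> Y)"
    using assms
    by (simp add: emeasure_uniform_count_measure card_cartesian_product ennreal_mult'[symmetric])
qed

text \<open>A power of an image measure is the image of the power under coordinatewise application.
  Hence drawing \<open>k\<close> times from the sample amounts to drawing one uniformly random index
  function, repetitions allowed.\<close>

lemma PiM_empirical:
  assumes n: "0 < n" and x: "x \<in> space (PiM {..<n} (\<lambda>_. M))"
  shows "PiM {..<k::nat} (\<lambda>_. empirical M n x) =
    distr (uniform_count_measure ({..<k} \<rightarrow>\<^sub>E {..<n})) (PiM {..<k} (\<lambda>_. M)) (compose {..<k} x)"
proof -
  have E: "empirical M n x \<in> space (prob_algebra M)"
    using measurable_space[OF measurable_empirical[OF n] x] .
  have m: "x \<in> uniform_count_measure {..<n} \<rightarrow>\<^sub>M M"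
    using x by (auto simp: space_PiM PiE_def Pi_def measurable_def sets_uniform_count_measure
        space_uniform_count_measure)
  have sets_E: "sets (empirical M n x) = sets M" by (simp add: empirical_def)
  \<comment> \<open>\<open>M\<close> is an arbitrary measure, so the target is replaced by
    \<open>empirical M n x\<close>, which is a probability. \<open>distr\<close> sees only the
    measurable sets of its target, and the last step returns to \<open>M\<close>.\<close>
  have "PiM {..<k} (\<lambda>_. empirical M n x) =
      PiM {..<k} (\<lambda>_. distr (uniform_count_measure {..<n}) (empirical M n x) x)"
    by (intro PiM_cong refl) (simp add: empirical_def cong: distr_cong)
  also have "\<dots> = distr (PiM {..<k} (\<lambda>_. uniform_count_measure {..<n}))
      (PiM {..<k} (\<lambda>_. empirical M n x)) (compose {..<k} x)"
    using n E m
    by (intro distr_PiM_finite_prob_space'[symmetric])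
       (auto intro!: prob_space_uniform_count_measure simp: space_prob_algebra
         cong: measurable_cong_sets)
  also have "PiM {..<k} (\<lambda>_. uniform_count_measure {..<n}) =
      uniform_count_measure ({..<k} \<rightarrow>\<^sub>E {..<n})"
    using n by (intro PiM_uniform_count_measure) auto
  also have "distr \<dots> (PiM {..<k} (\<lambda>_. empirical M n x)) (compose {..<k} x) =
      distr (uniform_count_measure ({..<k} \<rightarrow>\<^sub>E {..<n})) (PiM {..<k} (\<lambda>_. M)) (compose {..<k} x)"
    by (intro distr_cong refl sets_PiM_cong sets_E)
  finally show ?thesis .
qed

section \<open>The empirical mixture as an average over index functions\<close>

text \<open>Covers coordinate permutations, when \<open>f\<close> and \<open>g\<close> come from
  permutations, as well as draws with replacement, when they are arbitrary.\<close>

definition reindex ::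
    "nat \<Rightarrow> nat \<Rightarrow> (nat \<Rightarrow> nat) \<times> (nat \<Rightarrow> nat) \<Rightarrow>
     (nat \<Rightarrow> 'a) \<times> (nat \<Rightarrow> 'b) \<Rightarrow> (nat \<Rightarrow> 'a) \<times> (nat \<Rightarrow> 'b)"
  where "reindex k l = (\<lambda>(f, g) (x, y). (compose {..<k} x f, compose {..<l} y g))"

lemma measurable_compose_PiM:
  assumes "f \<in> {..<k::nat} \<rightarrow>\<^sub>E {..<n::nat}"
  shows "(\<lambda>x. compose {..<k} x f) \<in> PiM {..<n} (\<lambda>_. M) \<rightarrow>\<^sub>M PiM {..<k} (\<lambda>_. M)"
  unfolding compose_def using assms
  by (intro measurable_restrict measurable_component_singleton) (auto simp: PiE_def Pi_def)

lemma measurable_reindex: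
  assumes "h \<in> ({..<k1} \<rightarrow>\<^sub>E {..<n1}) \<times> ({..<k2} \<rightarrow>\<^sub>E {..<n2})"
  shows "reindex k1 k2 h \<in> two_prod M1 M2 n1 n2 \<rightarrow>\<^sub>M two_prod M1 M2 k1 k2"
proof -
  obtain f g where h: "h = (f, g)" by fastforce
  have [measurable]: "(\<lambda>x. compose {..<k1} x f) \<in> PiM {..<n1} (\<lambda>_. M1) \<rightarrow>\<^sub>M PiM {..<k1} (\<lambda>_. M1)"
    "(\<lambda>x. compose {..<k2} x g) \<in> PiM {..<n2} (\<lambda>_. M2) \<rightarrow>\<^sub>M PiM {..<k2} (\<lambda>_. M2)"
    using assms h by (auto intro!: measurable_compose_PiM)
  show ?thesis
    unfolding two_prod_def reindex_def h case_prod_beta' fst_conv snd_conv by measurable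
qed

text \<open>For a fixed sample \<open>z\<close> the product of powers is the image of the uniform
  law on \<open>F\<close>, so it measures \<open>A\<close> by a proportion of index pairs. The form
  as an average of indicators is ready for termwise integration over \<open>z\<close>.\<close>

lemma emeasure_two_prod_empirical:
  assumes n: "0 < n1" "0 < n2" and z: "z \<in> space (two_prod M1 M2 n1 n2)"
    and A: "A \<in> sets (two_prod M1 M2 k1 k2)"
  defines "F \<equiv> ({..<k1} \<rightarrow>\<^sub>E {..<n1}) \<times> ({..<k2} \<rightarrow>\<^sub>E {..<n2})"
  shows "emeasure (two_prod (empirical M1 n1 (fst z)) (empirical M2 n2 (snd z)) k1 k2) A =
    (\<Sum>h\<in>F. indicator A (reindex k1 k2 h z)) / of_nat (card F)"
proof -
  let ?F1 = "{..<k1} \<rightarrow>\<^sub>E {..<n1}" and ?F2 = "{..<k2} \<rightarrow>\<^sub>E {..<n2}"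
  obtain x y where z_eq: "z = (x, y)" by fastforce
  have xy: "x \<in> space (PiM {..<n1} (\<lambda>_. M1))" "y \<in> space (PiM {..<n2} (\<lambda>_. M2))"
    using z by (auto simp: z_eq two_prod_def space_pair_measure)
  have F: "finite ?F1" "?F1 \<noteq> {}" "finite ?F2" "?F2 \<noteq> {}"
    using n by (auto intro!: finite_PiE simp: PiE_eq_empty_iff)
  have m1: "compose {..<k1} x \<in> uniform_count_measure ?F1 \<rightarrow>\<^sub>M PiM {..<k1} (\<lambda>_. M1)"
    using xy(1) by (auto simp: measurable_def sets_uniform_count_measure
        space_uniform_count_measure space_PiM compose_def PiE_def Pi_def)
  have m2: "compose {..<k2} y \<in> uniform_count_measure ?F2 \<rightarrow>\<^sub>M PiM {..<k2} (\<lambda>_. M2)"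
    using xy(2) by (auto simp: measurable_def sets_uniform_count_measure
        space_uniform_count_measure space_PiM compose_def PiE_def Pi_def)
  interpret F2: prob_space "uniform_count_measure ?F2"
    using F by (intro prob_space_uniform_count_measure)
  interpret D2: prob_space "distr (uniform_count_measure ?F2) (PiM {..<k2} (\<lambda>_. M2)) (compose {..<k2} y)"
    by (rule F2.prob_space_distr[OF m2])
  have "two_prod (empirical M1 n1 x) (empirical M2 n2 y) k1 k2 =
      distr (uniform_count_measure F) (two_prod M1 M2 k1 k2) (\<lambda>h. reindex k1 k2 h z)"
    unfolding two_prod_def PiM_empirical[OF n(1) xy(1)] PiM_empirical[OF n(2) xy(2)]
    using F D2.sigma_finite_measure_axioms
    by (subst pair_measure_distr[OF m1 m2])
       (auto simp: pair_uniform_count_measure F_def z_eq reindex_def intro!: distr_cong)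
  moreover have "(\<lambda>h. reindex k1 k2 h z) \<in> uniform_count_measure F \<rightarrow>\<^sub>M two_prod M1 M2 k1 k2"
    using measurable_space[OF measurable_reindex z]
    by (auto simp: measurable_def sets_uniform_count_measure space_uniform_count_measure F_def)
  moreover have "finite F" using F by (simp add: F_def)
  moreover have "0 < card F" using F by (auto simp: F_def card_gt_0_iff)
  ultimately have "emeasure (two_prod (empirical M1 n1 x) (empirical M2 n2 y) k1 k2) A =
      ennreal (real (card {h\<in>F. reindex k1 k2 h z \<in> A}) / real (card F))"
    using A
    by (auto simp: emeasure_distr emeasure_uniform_count_measure space_uniform_count_measure
        intro!: arg_cong[where f = card])
  also have "\<dots> = of_nat (card {h\<in>F. reindex k1 k2 h z \<in> A}) / of_nat (card F)"
    using \<open>0 < card F\<close> by (simp add: divide_ennreal[symmetric] ennreal_of_nat_eq_real_of_nat)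
  also have "of_nat (card {h\<in>F. reindex k1 k2 h z \<in> A}) = (\<Sum>h\<in>F. indicator A (reindex k1 k2 h z) :: ennreal)"
    using \<open>finite F\<close> by (simp add: indicator_def sum.If_cases Int_def)
  finally show ?thesis by (simp add: z_eq)
qed

text \<open>Neither \<open>k1\<close> nor \<open>k2\<close> enters, so a single mixing measure
  serves all pairs at once.\<close>

definition empirical_mixing ::
    "'a measure \<Rightarrow> 'b measure \<Rightarrow> nat \<Rightarrow> nat \<Rightarrow> ((nat \<Rightarrow> 'a) \<times> (nat \<Rightarrow> 'b)) measure \<Rightarrow>
     ('a measure \<times> 'b measure) measure"
  where "empirical_mixing M1 M2 n1 n2 P =
    distr P (mixing_space M1 M2) (\<lambda>z. (empirical M1 n1 (fst z), empirical M2 n2 (snd z)))"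

lemma measurable_empirical_pair:
  assumes "0 < n1" "0 < n2" "sets P = sets (two_prod M1 M2 n1 n2)"
  shows "(\<lambda>z. (empirical M1 n1 (fst z), empirical M2 n2 (snd z))) \<in> P \<rightarrow>\<^sub>M mixing_space M1 M2"
proof -
  note measurable_empirical[OF assms(1), measurable] measurable_empirical[OF assms(2), measurable]
  show ?thesis
    unfolding measurable_cong_sets[OF assms(3) refl] two_prod_def by measurable
qed

lemma prob_space_empirical_mixing:
  assumes "0 < n1" "0 < n2" "sets P = sets (two_prod M1 M2 n1 n2)" "prob_space P"
  shows "prob_space (empirical_mixing M1 M2 n1 n2 P)"
  unfolding empirical_mixing_def
  using assms by (intro prob_space.prob_space_distr measurable_empirical_pair)

lemma sets_empirical_mixing [simp]:
  "sets (empirical_mixing M1 M2 n1 n2 P) = sets (mixing_space M1 M2)"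
  by (simp add: empirical_mixing_def)

text \<open>The proportion for a fixed sample is integrated over \<open>P\<close>, and the finite
  sum is exchanged with the integral. Each summand becomes the probability of \<open>A\<close> under
  one reindexed law.\<close>

lemma measure_mixture_empirical:
  assumes n: "0 < n1" "0 < n2" and sets_P: "sets P = sets (two_prod M1 M2 n1 n2)"
    and "prob_space P" and A: "A \<in> sets (two_prod M1 M2 k1 k2)"
  defines "F \<equiv> ({..<k1} \<rightarrow>\<^sub>E {..<n1}) \<times> ({..<k2} \<rightarrow>\<^sub>E {..<n2})"
  shows "measure (mixture k1 k2 (empirical_mixing M1 M2 n1 n2 P)) A =
    (\<Sum>h\<in>F. measure (distr P (two_prod M1 M2 k1 k2) (reindex k1 k2 h)) A) / real (card F)"
proof -
  interpret P: prob_space P by fact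
  let ?\<mu> = "empirical_mixing M1 M2 n1 n2 P"
  have sp: "space P = space (two_prod M1 M2 n1 n2)" by (rule sets_eq_imp_space_eq[OF sets_P])
  have finF: "finite F" "F \<noteq> {}"
    using n by (auto simp: F_def PiE_eq_empty_iff intro!: finite_PiE)
  then have cF: "0 < card F" by (simp add: card_gt_0_iff)
  have reindex_meas: "reindex k1 k2 h \<in> P \<rightarrow>\<^sub>M two_prod M1 M2 k1 k2" if "h \<in> F" for h
    using measurable_reindex that unfolding F_def measurable_cong_sets[OF sets_P refl] by blast
  have [measurable]: "(\<lambda>z. indicator A (reindex k1 k2 h z) :: ennreal) \<in> borel_measurable P"
    if "h \<in> F" for h
    using measurable_compose[OF reindex_meas[OF that] borel_measurable_indicator[OF A]] .
  \<comment> \<open>Measurability in the pair of mixed laws permits the change of variables from the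
    mixing measure back to \<open>P\<close>.\<close>
  have meas: "(\<lambda>q. emeasure (two_prod (fst q) (snd q) k1 k2) A) \<in> borel_measurable (mixing_space M1 M2)"
    using measurable_compose[OF measurable_prob_algebraD[OF measurable_two_prod]
        measurable_emeasure_subprob_algebra[OF A]]
    by (simp add: case_prod_beta')
  have "emeasure (mixture k1 k2 ?\<mu>) A = (\<integral>\<^sup>+q. emeasure (two_prod (fst q) (snd q) k1 k2) A \<partial>?\<mu>)"
    using emeasure_mixture[OF prob_space_empirical_mixing[OF n sets_P \<open>prob_space P\<close>] sets_empirical_mixing A]
    by (simp add: case_prod_beta')
  also have "\<dots> = (\<integral>\<^sup>+z. emeasure (two_prod (empirical M1 n1 (fst z)) (empirical M2 n2 (snd z)) k1 k2) A \<partial>P)"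
    unfolding empirical_mixing_def
    using meas by (subst nn_integral_distr[OF measurable_empirical_pair[OF n sets_P]]) simp_all
  also have "\<dots> = (\<integral>\<^sup>+z. (\<Sum>h\<in>F. indicator A (reindex k1 k2 h z)) / of_nat (card F) \<partial>P)"
    using emeasure_two_prod_empirical[OF n _ A] unfolding F_def sp[symmetric]
    by (intro nn_integral_cong)
  also have "\<dots> = (\<Sum>h\<in>F. \<integral>\<^sup>+z. indicator A (reindex k1 k2 h z) \<partial>P) / of_nat (card F)"
    by (subst nn_integral_divide) (auto simp: nn_integral_sum)
  also have "\<dots> = (\<Sum>h\<in>F. ennreal (measure (distr P (two_prod M1 M2 k1 k2) (reindex k1 k2 h)) A)) / of_nat (card F)"
  proof (intro arg_cong2[where f = "(/)"] sum.cong refl)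
    fix h assume h: "h \<in> F"
    interpret D: prob_space "distr P (two_prod M1 M2 k1 k2) (reindex k1 k2 h)"
      by (rule P.prob_space_distr[OF reindex_meas[OF h]])
    have "(\<integral>\<^sup>+z. indicator A (reindex k1 k2 h z) \<partial>P) =
        (\<integral>\<^sup>+w. indicator A w \<partial>distr P (two_prod M1 M2 k1 k2) (reindex k1 k2 h))"
      using A by (subst nn_integral_distr[OF reindex_meas[OF h]]) auto
    also have "\<dots> = ennreal (measure (distr P (two_prod M1 M2 k1 k2) (reindex k1 k2 h)) A)"
      using A by (simp add: D.emeasure_eq_measure)
    finally show "(\<integral>\<^sup>+z. indicator A (reindex k1 k2 h z) \<partial>P) =
        ennreal (measure (distr P (two_prod M1 M2 k1 k2) (reindex k1 k2 h)) A)" .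
  qed
  also have "\<dots> = ennreal ((\<Sum>h\<in>F. measure (distr P (two_prod M1 M2 k1 k2) (reindex k1 k2 h)) A) / real (card F))"
    using cF by (simp add: divide_ennreal[symmetric] ennreal_of_nat_eq_real_of_nat sum_nonneg)
  finally show ?thesis
    by (simp add: measure_def sum_nonneg)
qed

section \<open>Exchangeability and the upper bound\<close>

lemma measurable_projection:
  assumes "k1 \<le> n1" "k2 \<le> n2"
  shows "(\<lambda>(x, y). (restrict x {..<k1}, restrict y {..<k2})) \<in>
    two_prod M1 M2 n1 n2 \<rightarrow>\<^sub>M two_prod M1 M2 k1 k2"
proof -
  have [measurable]:
    "(\<lambda>x. restrict x {..<k1}) \<in> PiM {..<n1} (\<lambda>_. M1) \<rightarrow>\<^sub>M PiM {..<k1} (\<lambda>_. M1)"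
    "(\<lambda>x. restrict x {..<k2}) \<in> PiM {..<n2} (\<lambda>_. M2) \<rightarrow>\<^sub>M PiM {..<k2} (\<lambda>_. M2)"
    using assms by (auto intro!: measurable_restrict_subset)
  show ?thesis unfolding two_prod_def case_prod_beta' by measurable
qed

text \<open>Once \<open>f\<close> and \<open>g\<close> are extended to permutations, reindexing is
  permuting all coordinates and then projecting; the permutation leaves \<open>P\<close>
  unchanged.\<close>

lemma distr_reindex_inj:
  assumes P: "partially_exchangeable M1 M2 n1 n2 P" and h: "h \<in> inj_funs k1 n1 \<times> inj_funs k2 n2"
  shows "distr P (two_prod M1 M2 k1 k2) (reindex k1 k2 h) = projection M1 M2 k1 k2 P"
proof -
  let ?N = "two_prod M1 M2 n1 n2" and ?K = "two_prod M1 M2 k1 k2"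
  have sets_P: "sets P = sets ?N" using P by (simp add: partially_exchangeable_def)
  obtain f g where fg: "h = (f, g)" "f \<in> inj_funs k1 n1" "g \<in> inj_funs k2 n2" using h by auto
  have k: "k1 \<le> n1" "k2 \<le> n2" using inj_funs_le fg by auto
  obtain \<sigma> where \<sigma>: "\<sigma> permutes {..<n1}" "\<And>i. i < k1 \<Longrightarrow> \<sigma> i = f i"
    using inj_funs_extend_permutes[OF fg(2)] by blast
  obtain \<tau> where \<tau>: "\<tau> permutes {..<n2}" "\<And>i. i < k2 \<Longrightarrow> \<tau> i = g i"
    using inj_funs_extend_permutes[OF fg(3)] by blast
  \<comment> \<open>The permutations are cut down to extensional functions so that
    \<open>measurable_reindex\<close> applies to \<open>permute_coords\<close>.\<close>
  let ?h = "(restrict \<sigma> {..<n1}, restrict \<tau> {..<n2})"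
  have perm: "permute_coords n1 n2 \<sigma> \<tau> = reindex n1 n2 ?h"
    by (auto simp: permute_coords_def reindex_def compose_def fun_eq_iff)
  have "permute_coords n1 n2 \<sigma> \<tau> \<in> ?N \<rightarrow>\<^sub>M ?N"
    unfolding perm using permutes_in_image[OF \<sigma>(1)] permutes_in_image[OF \<tau>(1)]
    by (intro measurable_reindex) auto
  then have m: "permute_coords n1 n2 \<sigma> \<tau> \<in> P \<rightarrow>\<^sub>M ?N"
    unfolding measurable_cong_sets[OF sets_P refl] .
  have "projection M1 M2 k1 k2 P = projection M1 M2 k1 k2 (distr P ?N (permute_coords n1 n2 \<sigma> \<tau>))"
    using P \<sigma>(1) \<tau>(1) by (simp add: partially_exchangeable_def)
  also have "\<dots> = distr P ?K ((\<lambda>(x, y). (restrict x {..<k1}, restrict y {..<k2})) \<circ> permute_coords n1 n2 \<sigma> \<tau>)"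
    unfolding projection_def by (rule distr_distr[OF measurable_projection[OF k] m])
  also have "\<dots> = distr P ?K (reindex k1 k2 h)"
    using k \<sigma>(2) \<tau>(2)
    by (intro distr_cong) (auto simp: permute_coords_def reindex_def fg(1) compose_def fun_eq_iff)
  finally show ?thesis ..
qed

text \<open>The terms with index in \<open>I\<close> cancel against \<open>c\<close>, and each
  remaining one contributes at most \<open>1 / card F\<close>.\<close>

lemma abs_diff_average_le:
  fixes q :: "'i \<Rightarrow> real"
  assumes F: "finite F" "F \<noteq> {}" and I: "I \<subseteq> F"
    and q: "\<And>h. h \<in> F \<Longrightarrow> 0 \<le> q h \<and> q h \<le> 1" and c: "0 \<le> c" "c \<le> 1"
    and eq: "\<And>h. h \<in> I \<Longrightarrow> q h = c"
  shows "\<bar>c - (\<Sum>h\<in>F. q h) / card F\<bar> \<le> 1 - card I / card F"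
proof -
  have pos: "0 < real (card F)" using F by (simp add: card_gt_0_iff)
  have "c - (\<Sum>h\<in>F. q h) / card F = (\<Sum>h\<in>F. c - q h) / card F"
    using pos by (simp add: sum_subtractf field_simps)
  also have "(\<Sum>h\<in>F. c - q h) = (\<Sum>h\<in>F - I. c - q h)"
    using F I eq by (intro sum.mono_neutral_right) auto
  finally have "\<bar>c - (\<Sum>h\<in>F. q h) / card F\<bar> = \<bar>\<Sum>h\<in>F - I. c - q h\<bar> / card F"
    by simp
  also have "\<dots> \<le> (\<Sum>h\<in>F - I. 1) / card F"
  proof (intro divide_right_mono order_trans[OF sum_abs] sum_mono)
    fix h assume "h \<in> F - I"
    with q[of h] c show "\<bar>c - q h\<bar> \<le> 1" by auto
  qed auto
  also have "\<dots> = 1 - card I / card F"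
    using F I pos by (simp add: card_Diff_subset finite_subset of_nat_diff card_mono field_simps)
  finally show ?thesis .
qed

text \<open>Falling factorials count injections and powers count all index functions, so
  \<open>beta\<close> is the probability that at least one of two independent uniform samples with
  replacement has a repetition.\<close>

lemma beta_eq_card:
  assumes "k1 \<le> n1" "k2 \<le> n2"
  shows "beta (k1, k2) (n1, n2) =
    1 - (card (inj_funs k1 n1) / real n1 ^ k1) * (card (inj_funs k2 n2) / real n2 ^ k2)"
  using assms by (simp add: beta_def card_inj_funs field_simps)

lemma prob_space_projection:
  assumes P: "partially_exchangeable M1 M2 n1 n2 P" and k: "k1 \<le> n1" "k2 \<le> n2"
  shows "prob_space (projection M1 M2 k1 k2 P)"
proof -
  have "sets P = sets (two_prod M1 M2 n1 n2)" "prob_space P"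
    using P by (auto simp: partially_exchangeable_def)
  then show ?thesis
    unfolding projection_def using measurable_projection[OF k, of M1 M2]
    by (intro prob_space.prob_space_distr) (simp_all cong: measurable_cong_sets)
qed

lemma sets_projection [simp]: "sets (projection M1 M2 k1 k2 P) = sets (two_prod M1 M2 k1 k2)"
  by (simp add: projection_def)

text \<open>On each event only pairs that are not both injective contribute to the difference, which
  is thus at most \<open>beta\<close>. The factor 2 comes from passing from events to the
  norm.\<close>

lemma tv_norm_empirical_mixing_le:
  assumes P: "partially_exchangeable M1 M2 n1 n2 P"
    and n: "0 < n1" "0 < n2" and k: "k1 \<le> n1" "k2 \<le> n2"
  shows "tv_norm (projection M1 M2 k1 k2 P) (mixture k1 k2 (empirical_mixing M1 M2 n1 n2 P))
    \<le> 2 * beta (k1, k2) (n1, n2)"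
proof -
  have sets_P: "sets P = sets (two_prod M1 M2 n1 n2)" and "prob_space P"
    using P by (auto simp: partially_exchangeable_def)
  interpret P: prob_space P by fact
  let ?\<mu> = "empirical_mixing M1 M2 n1 n2 P" and ?K = "two_prod M1 M2 k1 k2"
  let ?Q = "projection M1 M2 k1 k2 P"
  interpret Q: prob_space ?Q using P k by (rule prob_space_projection)
  note mu = prob_space_empirical_mixing[OF n sets_P \<open>prob_space P\<close>]
  let ?F = "({..<k1} \<rightarrow>\<^sub>E {..<n1}) \<times> ({..<k2} \<rightarrow>\<^sub>E {..<n2})"
  let ?I = "inj_funs k1 n1 \<times> inj_funs k2 n2"
  have F: "finite ?F" "?F \<noteq> {}"
    using n by (auto simp: PiE_eq_empty_iff intro!: finite_PiE)
  have beta: "beta (k1, k2) (n1, n2) = 1 - card ?I / card ?F"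
    using k by (simp add: beta_eq_card card_cartesian_product card_PiE)
  have "\<bar>measure ?Q A - measure (mixture k1 k2 ?\<mu>) A\<bar> \<le> beta (k1, k2) (n1, n2)"
    if A: "A \<in> sets ?K" for A
    unfolding measure_mixture_empirical[OF n sets_P \<open>prob_space P\<close> A] beta
  proof (rule abs_diff_average_le[OF F])
    show "?I \<subseteq> ?F" using inj_funs_subset by (intro Sigma_mono) auto
    show "measure (distr P ?K (reindex k1 k2 h)) A = measure ?Q A" if "h \<in> ?I" for h
      by (simp only: distr_reindex_inj[OF P that])
    show "0 \<le> measure (distr P ?K (reindex k1 k2 h)) A \<and>
        measure (distr P ?K (reindex k1 k2 h)) A \<le> 1" if h: "h \<in> ?F" for h
    proof -
      have "reindex k1 k2 h \<in> P \<rightarrow>\<^sub>M ?K"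
        using measurable_reindex[OF h] unfolding measurable_cong_sets[OF sets_P refl] .
      then show ?thesis using prob_space.prob_le_1[OF P.prob_space_distr] by auto
    qed
  qed auto
  then have "(SUP A\<in>sets ?Q. \<bar>measure ?Q A - measure (mixture k1 k2 ?\<mu>) A\<bar>) \<le> beta (k1, k2) (n1, n2)"
    using sets.sets_into_space by (intro cSUP_least) auto
  then show ?thesis
    by (subst tv_norm_eq_SUP)
       (auto simp: sets_mixture[OF mu sets_empirical_mixing] Q.prob_space_axioms
         intro: prob_space_mixture[OF mu sets_empirical_mixing])
qed

section \<open>Distinct draws under an arbitrary mixture: the lower bound\<close>

lemma tv_norm_ge:
  assumes "prob_space P" "prob_space Q" "sets Q = sets P" and A: "A \<in> sets P"
  shows "2 * \<bar>measure P A - measure Q A\<bar> \<le> tv_norm P Q"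
proof -
  interpret P: prob_space P by fact
  interpret Q: prob_space Q by fact
  have "\<bar>measure P B - measure Q B\<bar> \<le> 1" for B
    using P.prob_le_1[of B] Q.prob_le_1[of B] measure_nonneg[of P B] measure_nonneg[of Q B] by linarith
  then have "\<bar>measure P A - measure Q A\<bar> \<le> (SUP A\<in>sets P. \<bar>measure P A - measure Q A\<bar>)"
    using A by (intro cSUP_upper) (auto intro!: bdd_aboveI[of _ 1])
  then show ?thesis using tv_norm_eq_SUP[OF assms(1-3)] by simp
qed

text \<open>Over finite alphabets every subset of the product is measurable, so measurability of the
  events below is a matter of inclusion.\<close>

lemma two_prod_count_space:
  "two_prod (count_space {..<n1::nat}) (count_space {..<n2::nat}) k1 k2 =
    count_space (({..<k1} \<rightarrow>\<^sub>E {..<n1}) \<times> ({..<k2} \<rightarrow>\<^sub>E {..<n2}))"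
  unfolding two_prod_def
  by (simp add: count_space_PiM_finite pair_measure_countable countable_finite finite_PiE)

text \<open>The event splits into atoms \<open>{f}\<close> of mass
  \<open>\<Prod>i<k. measure p {f i}\<close>; Maclaurin's inequality applies with the weights
  \<open>measure p {j}\<close>.\<close>

lemma measure_PiM_inj_funs_le:
  assumes p: "p \<in> space (prob_algebra (count_space {..<n}))" and n: "0 < n" and k: "k \<le> n"
  shows "measure (PiM {..<k} (\<lambda>_. p)) (inj_funs k n) \<le> card (inj_funs k n) / real n ^ k"
proof -
  have sets_p: "sets p = Pow {..<n}" and "prob_space p"
    using p by (auto simp: space_prob_algebra)
  have space_p: "space p = {..<n}"
    using sets_eq_imp_space_eq[of p "count_space {..<n}"] sets_p by simp
  interpret p: prob_space p by fact
  interpret product_prob_space "\<lambda>_::nat. p" "{..<k}" ..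
  have sing: "measure (PiM {..<k} (\<lambda>_. p)) {f} = (\<Prod>i<k. measure p {f i})"
    if "f \<in> {..<k} \<rightarrow>\<^sub>E {..<n}" for f
  proof -
    \<comment> \<open>A single tuple is the box of its one-point sides, so the product formula
      applies to it.\<close>
    have "emeasure (PiM {..<k} (\<lambda>_. p)) (\<Pi>\<^sub>E i\<in>{..<k}. {f i}) = (\<Prod>i<k. emeasure p {f i})"
      using that sets_p by (intro emeasure_PiM) (auto simp: PiE_def Pi_def)
    moreover have "(\<Pi>\<^sub>E i\<in>{..<k}. {f i}) = {f}"
      using that by (intro PiE_singleton) (auto simp: PiE_def)
    ultimately show ?thesis
      by (simp add: p.emeasure_eq_measure P.emeasure_eq_measure prod_ennreal prod_nonneg)
  qed
  have sets_k: "sets (PiM {..<k} (\<lambda>_. p)) = Pow ({..<k} \<rightarrow>\<^sub>E {..<n})"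
    using sets_PiM_cong[of "{..<k}" "{..<k}" "\<lambda>_. p" "\<lambda>_. count_space {..<n}"] sets_p
    by (simp add: count_space_PiM_finite)
  have "measure (PiM {..<k} (\<lambda>_. p)) (inj_funs k n) =
      (\<Sum>f\<in>inj_funs k n. measure (PiM {..<k} (\<lambda>_. p)) {f})"
    using inj_funs_subset[of k n] by (intro P.finite_measure_eq_sum_singleton) (auto simp: sets_k)
  also have "\<dots> = (\<Sum>f\<in>inj_funs k n. \<Prod>i<k. measure p {f i})"
    using inj_funs_subset by (intro sum.cong refl sing) blast
  also have "\<dots> \<le> card (inj_funs k n) / real n ^ k"
  proof (rule sum_prod_inj_funs_le[OF _ _ k n])
    show "(\<Sum>j<n. measure p {j}) = 1"
      using p.finite_measure_eq_sum_singleton[of "{..<n}"] p.prob_space by (simp add: sets_p space_p)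
  qed simp
  finally show ?thesis .
qed

text \<open>The bound \<open>w1 * w2\<close> holds for every pair \<open>(p1, p2)\<close>, hence
  survives integration against any mixing measure; by \<open>beta_eq_card\<close> it equals
  \<open>1 - beta\<close>.\<close>

lemma measure_mixture_inj_funs_le:
  assumes mu: "prob_space \<mu>"
      "sets \<mu> = sets (mixing_space (count_space {..<n1}) (count_space {..<n2}))"
    and n: "0 < n1" "0 < n2" and k: "k1 \<le> n1" "k2 \<le> n2"
  shows "measure (mixture k1 k2 \<mu>) (inj_funs k1 n1 \<times> inj_funs k2 n2) \<le> 1 - beta (k1, k2) (n1, n2)"
proof -
  interpret mu: prob_space \<mu> by fact
  let ?I1 = "inj_funs k1 n1" and ?I2 = "inj_funs k2 n2"
  define w1 where "w1 = card ?I1 / real n1 ^ k1"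
  define w2 where "w2 = card ?I2 / real n2 ^ k2"
  have w: "0 \<le> w1" "0 \<le> w2" by (auto simp: w1_def w2_def)
  have A: "?I1 \<times> ?I2 \<in> sets (two_prod (count_space {..<n1}) (count_space {..<n2}) k1 k2)"
    using inj_funs_subset[of k1 n1] inj_funs_subset[of k2 n2] by (auto simp: two_prod_count_space)
  have "emeasure (two_prod p1 p2 k1 k2) (?I1 \<times> ?I2) \<le> ennreal (w1 * w2)"
    if "(p1, p2) \<in> space \<mu>" for p1 p2
  proof -
    have p: "p1 \<in> space (prob_algebra (count_space {..<n1}))" "p2 \<in> space (prob_algebra (count_space {..<n2}))"
      using that sets_eq_imp_space_eq[OF mu(2)] by (auto simp: space_pair_measure)
    interpret p1: prob_space "PiM {..<k1} (\<lambda>_. p1)"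
      using p by (intro prob_space_PiM) (auto simp: space_prob_algebra)
    interpret p2: prob_space "PiM {..<k2} (\<lambda>_. p2)"
      using p by (intro prob_space_PiM) (auto simp: space_prob_algebra)
    have "?I1 \<in> sets (PiM {..<k1} (\<lambda>_. p1))" "?I2 \<in> sets (PiM {..<k2} (\<lambda>_. p2))"
      using p inj_funs_subset
        sets_PiM_cong[of "{..<k1}" "{..<k1}" "\<lambda>_. p1" "\<lambda>_. count_space {..<n1}"]
        sets_PiM_cong[of "{..<k2}" "{..<k2}" "\<lambda>_. p2" "\<lambda>_. count_space {..<n2}"]
      by (auto simp: count_space_PiM_finite space_prob_algebra)
    then have "emeasure (two_prod p1 p2 k1 k2) (?I1 \<times> ?I2) =
        ennreal (measure (PiM {..<k1} (\<lambda>_. p1)) ?I1 * measure (PiM {..<k2} (\<lambda>_. p2)) ?I2)"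
      unfolding two_prod_def
      by (simp add: p2.emeasure_pair_measure_Times p1.emeasure_eq_measure p2.emeasure_eq_measure ennreal_mult)
    also have "\<dots> \<le> ennreal (w1 * w2)"
      unfolding w1_def w2_def using p n k
      by (intro ennreal_leI mult_mono measure_PiM_inj_funs_le) auto
    finally show ?thesis .
  qed
  then have "emeasure (mixture k1 k2 \<mu>) (?I1 \<times> ?I2) \<le> (\<integral>\<^sup>+q. ennreal (w1 * w2) \<partial>\<mu>)"
    unfolding emeasure_mixture[OF mu A] by (intro nn_integral_mono) auto
  also have "\<dots> = ennreal (w1 * w2)"
    by (simp add: mu.emeasure_space_1)
  finally have "measure (mixture k1 k2 \<mu>) (?I1 \<times> ?I2) \<le> w1 * w2"
    using w by (simp add: measure_def enn2real_leI)
  then show ?thesis using k by (simp add: beta_eq_card w1_def w2_def)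
qed

section \<open>Sampling without replacement and tightness\<close>

lemma inj_funs_self_nonempty: "inj_funs n n \<noteq> {}"
proof -
  have "restrict id {..<n} \<in> inj_funs n n" by (auto simp: inj_funs_def inj_on_def)
  then show ?thesis by blast
qed

lemma distr_bij_uniform_count_measure:
  assumes f: "bij_betw f A B" and A: "finite A"
  shows "distr (uniform_count_measure A) (uniform_count_measure B) f = uniform_count_measure B"
proof (rule measure_eqI)
  fix X assume "X \<in> sets (distr (uniform_count_measure A) (uniform_count_measure B) f)"
  then have X: "X \<subseteq> B" by (simp add: sets_uniform_count_measure)
  have B: "finite B" using f A bij_betw_finite by blast
  have m: "f \<in> uniform_count_measure A \<rightarrow>\<^sub>M uniform_count_measure B"
    using f by (auto simp: measurable_def sets_uniform_count_measure space_uniform_count_measure bij_betw_def)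
  have "f ` (f -` X \<inter> A) = X" using f X by (auto simp: bij_betw_def)
  moreover have "inj_on f (f -` X \<inter> A)"
    using f by (auto simp: bij_betw_def intro: inj_on_subset)
  ultimately have "card (f -` X \<inter> A) = card X"
    using card_image by fastforce
  then show "emeasure (distr (uniform_count_measure A) (uniform_count_measure B) f) X =
      emeasure (uniform_count_measure B) X"
    using X A B m bij_betw_same_card[OF f]
    by (simp add: emeasure_distr sets_uniform_count_measure space_uniform_count_measure
        emeasure_uniform_count_measure)
qed simp

lemma restrict_comp_permutes_inj_funs:
  assumes \<sigma>: "\<sigma> permutes {..<n}" and f: "f \<in> inj_funs n m"
  shows "(\<lambda>i\<in>{..<n}. f (\<sigma> i)) \<in> inj_funs n m"
proof -
  have "inj_on (f \<circ> \<sigma>) {..<n}"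
    using f permutes_inj_on[OF \<sigma>]
    by (intro comp_inj_on) (auto simp: permutes_image[OF \<sigma>] inj_funs_def)
  then have "inj_on (\<lambda>i\<in>{..<n}. f (\<sigma> i)) {..<n}"
    by (subst inj_on_cong[of _ _ "f \<circ> \<sigma>"]) auto
  then show ?thesis
    using f permutes_in_image[OF \<sigma>] by (auto simp: inj_funs_def PiE_iff)
qed

text \<open>\<open>\<pi>'\<close> maps \<open>{..<n}\<close> into itself, so there the inner
  restriction takes effect; outside, both sides have the default value.\<close>

lemma restrict_comp_inverse:
  assumes "f \<in> extensional {..<n::nat}" "\<pi>' permutes {..<n}" "\<And>i. \<pi> (\<pi>' i) = i"
  shows "(\<lambda>i\<in>{..<n}. (\<lambda>i\<in>{..<n}. f (\<pi> i)) (\<pi>' i)) = f"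
  using assms permutes_in_image[OF assms(2)] by (auto simp: fun_eq_iff extensional_def)

lemma bij_betw_permute_coords_inj_funs:
  assumes \<sigma>: "\<sigma> permutes {..<n1}" and \<tau>: "\<tau> permutes {..<n2}"
  shows "bij_betw (permute_coords n1 n2 \<sigma> \<tau>) (inj_funs n1 m1 \<times> inj_funs n2 m2)
    (inj_funs n1 m1 \<times> inj_funs n2 m2)"
proof (rule bij_betw_byWitness)
  let ?I = "inj_funs n1 m1 \<times> inj_funs n2 m2"
  let ?T = "permute_coords n1 n2 \<sigma> \<tau>" and ?T' = "permute_coords n1 n2 (inv \<sigma>) (inv \<tau>)"
  note inv = permutes_inv[OF \<sigma>] permutes_inv[OF \<tau>]
  show "\<forall>z\<in>?I. ?T' (?T z) = z"
    using inv permutes_inverses(1)[OF \<sigma>] permutes_inverses(1)[OF \<tau>]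
    by (auto simp: permute_coords_def inj_funs_def PiE_def simp del: restrict_apply
        intro!: restrict_comp_inverse[where \<pi> = \<sigma>] restrict_comp_inverse[where \<pi> = \<tau>])
  show "\<forall>z\<in>?I. ?T (?T' z) = z"
    using \<sigma> \<tau> permutes_inverses(2)[OF \<sigma>] permutes_inverses(2)[OF \<tau>]
    by (auto simp: permute_coords_def inj_funs_def PiE_def simp del: restrict_apply
        intro!: restrict_comp_inverse[where \<pi> = "inv \<sigma>"] restrict_comp_inverse[where \<pi> = "inv \<tau>"])
  show "?T ` ?I \<subseteq> ?I" "?T' ` ?I \<subseteq> ?I"
    by (auto simp: permute_coords_def
        intro!: restrict_comp_permutes_inj_funs[OF \<sigma>] restrict_comp_permutes_inj_funs[OF \<tau>]
          restrict_comp_permutes_inj_funs[OF inv(1)] restrict_comp_permutes_inj_funs[OF inv(2)])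
qed

text \<open>\<open>inj_funs n n\<close> consists of the orderings of \<open>{..<n}\<close>. The
  image under \<open>id\<close> only moves the uniform law to the whole product space, where all
  other tuples get mass 0.\<close>

definition sampling_without_replacement :: "nat \<Rightarrow> nat \<Rightarrow> ((nat \<Rightarrow> nat) \<times> (nat \<Rightarrow> nat)) measure"
  where "sampling_without_replacement n1 n2 =
    distr (uniform_count_measure (inj_funs n1 n1 \<times> inj_funs n2 n2))
      (two_prod (count_space {..<n1}) (count_space {..<n2}) n1 n2) id"

lemma measurable_id_sampling:
  "id \<in> uniform_count_measure (inj_funs n1 n1 \<times> inj_funs n2 n2) \<rightarrow>\<^sub>M
    two_prod (count_space {..<n1}) (count_space {..<n2}) n1 n2"
proof -
  have "inj_funs n1 n1 \<times> inj_funs n2 n2 \<subseteq> ({..<n1} \<rightarrow>\<^sub>E {..<n1}) \<times> ({..<n2} \<rightarrow>\<^sub>E {..<n2})"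
    by (intro Sigma_mono inj_funs_subset)
  then show ?thesis
    unfolding measurable_def two_prod_count_space sets_uniform_count_measure space_uniform_count_measure
    by auto
qed

text \<open>Permuting coordinates is a bijection on pairs of orderings, and a bijection preserves
  the uniform law.\<close>

lemma partially_exchangeable_sampling:
  "partially_exchangeable (count_space {..<n1}) (count_space {..<n2}) n1 n2
    (sampling_without_replacement n1 n2)"
  unfolding partially_exchangeable_def
proof (intro conjI allI impI)
  let ?N = "two_prod (count_space {..<n1}) (count_space {..<n2}) n1 n2"
  let ?I = "inj_funs n1 n1 \<times> inj_funs n2 n2"
  let ?U = "uniform_count_measure ?I"
  have I: "finite ?I" "?I \<noteq> {}"
    using inj_funs_self_nonempty by auto
  show "prob_space (sampling_without_replacement n1 n2)"
    unfolding sampling_without_replacement_def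
    by (intro prob_space.prob_space_distr prob_space_uniform_count_measure measurable_id_sampling I)
  show "sets (sampling_without_replacement n1 n2) = sets ?N"
    by (simp add: sampling_without_replacement_def)
  fix \<sigma> \<tau> assume perm: "\<sigma> permutes {..<n1}" "\<tau> permutes {..<n2}"
  let ?T = "permute_coords n1 n2 \<sigma> \<tau> :: (nat \<Rightarrow> nat) \<times> (nat \<Rightarrow> nat) \<Rightarrow> _"
  have bij: "bij_betw ?T ?I ?I" using perm by (rule bij_betw_permute_coords_inj_funs)
  have TN: "?T \<in> ?N \<rightarrow>\<^sub>M ?N"
    using permutes_in_image[OF perm(1)] permutes_in_image[OF perm(2)]
    by (auto simp: two_prod_count_space permute_coords_def PiE_iff)
  have TU: "?T \<in> ?U \<rightarrow>\<^sub>M ?U"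
    using bij by (auto simp: measurable_def sets_uniform_count_measure space_uniform_count_measure bij_betw_def)
  have "distr (sampling_without_replacement n1 n2) ?N ?T = distr ?U ?N (?T \<circ> id)"
    unfolding sampling_without_replacement_def by (rule distr_distr[OF TN measurable_id_sampling])
  \<comment> \<open>The permutation is moved in front of the embedding \<open>id\<close>, so that it
    acts on the uniform law itself.\<close>
  also have "\<dots> = distr (distr ?U ?U ?T) ?N id"
    by (subst distr_distr[OF measurable_id_sampling TU]) simp
  also have "distr ?U ?U ?T = ?U"
    using bij I(1) by (rule distr_bij_uniform_count_measure)
  finally show "distr (sampling_without_replacement n1 n2) ?N ?T = sampling_without_replacement n1 n2"
    by (simp only: sampling_without_replacement_def)
qed

text \<open>Restrictions of injective tuples are injective, so the preimage of the event is the
  whole space.\<close>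

lemma measure_projection_sampling:
  assumes k: "k1 \<le> n1" "k2 \<le> n2"
  shows "measure (projection (count_space {..<n1}) (count_space {..<n2}) k1 k2
    (sampling_without_replacement n1 n2)) (inj_funs k1 n1 \<times> inj_funs k2 n2) = 1"
proof -
  let ?N = "two_prod (count_space {..<n1}) (count_space {..<n2}) n1 n2"
  let ?K = "two_prod (count_space {..<n1}) (count_space {..<n2}) k1 k2"
  let ?I = "inj_funs n1 n1 \<times> inj_funs n2 n2" and ?A = "inj_funs k1 n1 \<times> inj_funs k2 n2"
  let ?U = "uniform_count_measure ?I"
  let ?\<pi> = "\<lambda>(x, y). (restrict x {..<k1}, restrict y {..<k2})"
  interpret U: prob_space ?U
    using inj_funs_self_nonempty by (intro prob_space_uniform_count_measure) auto
  note proj = measurable_projection[OF k, of "count_space {..<n1}" "count_space {..<n2}"]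
  have A: "?A \<in> sets ?K"
    using inj_funs_subset[of k1 n1] inj_funs_subset[of k2 n2] by (auto simp: two_prod_count_space)
  have restr: "restrict f {..<k} \<in> inj_funs k n" if "f \<in> inj_funs n n" "k \<le> n" for f k n
    using that by (auto simp: inj_funs_def PiE_iff inj_on_def)
  have "measure (projection (count_space {..<n1}) (count_space {..<n2}) k1 k2
      (sampling_without_replacement n1 n2)) ?A = measure (distr ?U ?K (?\<pi> \<circ> id)) ?A"
    unfolding projection_def sampling_without_replacement_def
    by (subst distr_distr[OF proj measurable_id_sampling]) simp
  also have "\<dots> = measure ?U ((?\<pi> \<circ> id) -` ?A \<inter> space ?U)"
    by (rule measure_distr[OF measurable_comp[OF measurable_id_sampling proj] A])
  also have "(?\<pi> \<circ> id) -` ?A \<inter> space ?U = space ?U"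
    using k by (auto simp: space_uniform_count_measure intro!: restr)
  finally show ?thesis by (simp add: U.prob_space)
qed

text \<open>The single event \<open>?A\<close> already separates the laws: it has mass 1 under the
  projection and at most \<open>1 - beta\<close> under any mixture.\<close>

lemma tv_norm_sampling_ge:
  assumes n: "0 < n1" "0 < n2" and k: "k1 \<le> n1" "k2 \<le> n2"
    and mu: "prob_space \<mu>"
      "sets \<mu> = sets (mixing_space (count_space {..<n1}) (count_space {..<n2}))"
  shows "2 * beta (k1, k2) (n1, n2) \<le>
    tv_norm (projection (count_space {..<n1}) (count_space {..<n2}) k1 k2
      (sampling_without_replacement n1 n2)) (mixture k1 k2 \<mu>)"
proof -
  let ?Q = "projection (count_space {..<n1}) (count_space {..<n2}) k1 k2 (sampling_without_replacement n1 n2)"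
  let ?A = "inj_funs k1 n1 \<times> inj_funs k2 n2"
  have "2 * beta (k1, k2) (n1, n2) \<le> 2 * \<bar>measure ?Q ?A - measure (mixture k1 k2 \<mu>) ?A\<bar>"
    using measure_mixture_inj_funs_le[OF mu n k] measure_projection_sampling[OF k] by simp
  also have "2 * \<bar>measure ?Q ?A - measure (mixture k1 k2 \<mu>) ?A\<bar> \<le> tv_norm ?Q (mixture k1 k2 \<mu>)"
  proof (rule tv_norm_ge)
    show "prob_space ?Q" using partially_exchangeable_sampling k by (rule prob_space_projection)
    show "prob_space (mixture k1 k2 \<mu>)" using mu by (rule prob_space_mixture)
    show "sets (mixture k1 k2 \<mu>) = sets ?Q" using sets_mixture[OF mu] by simp
    show "?A \<in> sets ?Q"
      using inj_funs_subset[of k1 n1] inj_funs_subset[of k2 n2] by (auto simp: two_prod_count_space)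
  qed
  finally show ?thesis .
qed

text \<open>Tightness is taken in a strong sense: for one \<open>P\<close>, a single mixing measure
  attains the bound at all \<open>k1\<close>, \<open>k2\<close>, and none improves on it at any of
  them. The spaces \<open>N1\<close>, \<open>N2\<close> have to be chosen, since over one-point
  spaces the norm is always 0.\<close>

theorem theorem3:
  fixes M1 :: "'a measure" and M2 :: "'b measure" and n1 n2 :: nat
  assumes "0 < n1" and "0 < n2"
  shows "(\<forall>P. partially_exchangeable M1 M2 n1 n2 P \<longrightarrow>
           (\<exists>\<mu>. prob_space \<mu> \<and> sets \<mu> = sets (mixing_space M1 M2) \<and>
             (\<forall>k1 \<in> {1..n1}. \<forall>k2 \<in> {1..n2}.
               tv_norm (projection M1 M2 k1 k2 P) (mixture k1 k2 \<mu>)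
                 \<le> 2 * beta (k1, k2) (n1, n2)))) \<and>
         (\<exists>(N1 :: nat measure) (N2 :: nat measure) P.
           partially_exchangeable N1 N2 n1 n2 P \<and>
           (\<exists>\<mu>. prob_space \<mu> \<and> sets \<mu> = sets (mixing_space N1 N2) \<and>
             (\<forall>k1 \<in> {1..n1}. \<forall>k2 \<in> {1..n2}.
               tv_norm (projection N1 N2 k1 k2 P) (mixture k1 k2 \<mu>)
                 = 2 * beta (k1, k2) (n1, n2))) \<and>
           (\<forall>\<mu>. prob_space \<mu> \<longrightarrow> sets \<mu> = sets (mixing_space N1 N2) \<longrightarrow>
             (\<forall>k1 \<in> {1..n1}. \<forall>k2 \<in> {1..n2}.
               tv_norm (projection N1 N2 k1 k2 P) (mixture k1 k2 \<mu>)
                 \<ge> 2 * beta (k1, k2) (n1, n2))))"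
proof (intro conjI allI impI)
  fix P assume P: "partially_exchangeable M1 M2 n1 n2 P"
  then have "sets P = sets (two_prod M1 M2 n1 n2)" "prob_space P"
    by (auto simp: partially_exchangeable_def)
  then show "\<exists>\<mu>. prob_space \<mu> \<and> sets \<mu> = sets (mixing_space M1 M2) \<and>
      (\<forall>k1\<in>{1..n1}. \<forall>k2\<in>{1..n2}.
        tv_norm (projection M1 M2 k1 k2 P) (mixture k1 k2 \<mu>) \<le> 2 * beta (k1, k2) (n1, n2))"
    using assms P
    by (intro exI[of _ "empirical_mixing M1 M2 n1 n2 P"] conjI prob_space_empirical_mixing)
       (auto intro: tv_norm_empirical_mixing_le)
next
  let ?N1 = "count_space {..<n1}" and ?N2 = "count_space {..<n2}"
  let ?P = "sampling_without_replacement n1 n2"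
  \<comment> \<open>The measure from the upper bound also attains equality, because the lower bound
    holds for every mixing measure.\<close>
  let ?\<mu> = "empirical_mixing ?N1 ?N2 n1 n2 ?P"
  have P: "partially_exchangeable ?N1 ?N2 n1 n2 ?P" by (rule partially_exchangeable_sampling)
  then have "prob_space ?\<mu>"
    using assms by (intro prob_space_empirical_mixing) (auto simp: partially_exchangeable_def)
  then have "tv_norm (projection ?N1 ?N2 k1 k2 ?P) (mixture k1 k2 ?\<mu>) = 2 * beta (k1, k2) (n1, n2)"
    if "k1 \<in> {1..n1}" "k2 \<in> {1..n2}" for k1 k2
    using that assms P
    by (intro antisym tv_norm_empirical_mixing_le tv_norm_sampling_ge) auto
  with P \<open>prob_space ?\<mu>\<close> assms show "\<exists>(N1 :: nat measure) (N2 :: nat measure) P.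
      partially_exchangeable N1 N2 n1 n2 P \<and>
      (\<exists>\<mu>. prob_space \<mu> \<and> sets \<mu> = sets (mixing_space N1 N2) \<and>
        (\<forall>k1\<in>{1..n1}. \<forall>k2\<in>{1..n2}.
          tv_norm (projection N1 N2 k1 k2 P) (mixture k1 k2 \<mu>) = 2 * beta (k1, k2) (n1, n2))) \<and>
      (\<forall>\<mu>. prob_space \<mu> \<longrightarrow> sets \<mu> = sets (mixing_space N1 N2) \<longrightarrow>
        (\<forall>k1\<in>{1..n1}. \<forall>k2\<in>{1..n2}.
          tv_norm (projection N1 N2 k1 k2 P) (mixture k1 k2 \<mu>) \<ge> 2 * beta (k1, k2) (n1, n2)))"
    by (intro exI[of _ ?N1] exI[of _ ?N2] exI[of _ ?P] conjI exI[of _ ?\<mu>] allI impI ballI)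
       (auto intro: tv_norm_sampling_ge)
qed

end
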